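(* Let $A$ be a complex $n\times n$ matrix all of whose eigenvalues have positive real parts. Let $F:\mathbb C^n\to\mathbb C^n$ be continuous with $|F(x)|=\mathcal O(|x|^\beta)$ as $x\to0$ for some $\beta>1$, and let $f:[T,\infty)\to\mathbb C^n$, for some $T\ge0$, be continuous. Assume there exist integers $k\ge m\ge0$, a number $\mu>0$, a function $p\in\mathscr P_m(k,-\mu,\mathbb C^n)$ and a number $\delta_0>0$ such that $$|f(t)-p(\widehat{\mathcal L}_k(t))|=\mathcal O(L_m(t)^{-\mu-\delta_0})\quad\text{as }t\to\infty.$$ Let $y\in C^1([T_0,\infty),\mathbb C^n)$, for some $T_0>0$ with $T_0\ge T$, satisfy $y'+Ay=F(y)+f(t)$ on $(T_0,\infty)$ and $\lim_{t\to\infty}y(t)=0$. Then there is $\varepsilon>0$ such that $$|y(t)-(\mathcal Z_Ap)(\widehat{\mathcal L}_k(t))|=\mathcal O(L_m(t)^{-\mu-\varepsilon})\quad\text{as }t\to\infty.$$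
   Context: Iterated functions: $E_0(t)=t$, $E_{m+1}(t)=e^{E_m(t)}$; $L_{-1}(t)=e^t$, $L_0(t)=t$, $L_{m+1}(t)=\ln L_m(t)$ for $t>E_m(0)$, $m\ge 0$. $\widehat{\mathcal L}_k(t)=(L_{-1}(t),L_0(t),\dots,L_k(t))$. For $z=(z_{-1},z_0,\dots,z_k)\in(0,\infty)^{k+2}$ and $\alpha=(\alpha_{-1},\dots,\alpha_k)\in\mathbb C^{k+2}$, $z^\alpha=\prod_{j=-1}^kz_j^{\alpha_j}$, where $t^w=e^{w\ln t}$ for $t>0$, $w\in\mathbb C$. $\mathcal E_{\mathbb C}(m,k,\mu)$ is the set of $\alpha\in\mathbb C^{k+2}$ with $\operatorname{Re}\alpha_j=0$ for $-1\le j<m$ and $\operatorname{Re}\alpha_m=\mu$. $\mathscr P_m(k,\mu,\mathbb C^n)$ is the set of functions $p(z)=\sum_{\alpha\in S}z^\alpha\xi_\alpha$, $z\in(0,\infty)^{k+2}$, with $S$ a finite subset of $\mathcal E_{\mathbb C}(m,k,\mu)$ and $\xi_\alpha\in\mathbb C^n$. For such $p$ with $m\ge0$ (so $\operatorname{Re}\alpha_{-1}=0$ for all $\alpha\in S$, whence $A+\alpha_{-1}I_n$ is invertible), $(\mathcal Z_Ap)(z)=\sum_{\alpha\in S}z^\alpha(A+\alpha_{-1}I_n)^{-1}\xi_\alpha$. *)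

theory Defs
  imports "HOL-Analysis.Analysis" "HOL-Library.Landau_Symbols"
begin

primrec iter_exp :: "nat \<Rightarrow> real \<Rightarrow> real" where
  "iter_exp 0 t = t"
| "iter_exp (Suc m) t = exp (iter_exp m t)"

text \<open>
  Components of vectors are indexed by the integers \<open>-1, 0, \<dots>, k\<close>. The iterated logarithm of
  level \<open>m + 1\<close> is meaningful for \<open>t\<close> above the value at \<open>0\<close> of the \<open>m\<close>-fold iterated
  exponential (see \<open>iter_log_gt\<close>); below that threshold it takes junk values, which are
  irrelevant to behaviour as \<open>t\<close> tends to infinity.
\<close>

definition iter_log :: "int \<Rightarrow> real \<Rightarrow> real" where
  "iter_log j t = (if j < 0 then exp t else (ln ^^ nat j) t)"

lemma iter_log_simps:
  "iter_log (-1) t = exp t"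
  "iter_log 0 t = t"
  "0 \<le> m \<Longrightarrow> iter_log (m + 1) t = ln (iter_log m t)"
  by (simp_all add: iter_log_def nat_add_distrib)

lemma iter_exp_exp: "iter_exp m (exp s) = iter_exp (Suc m) s"
  by (induction m) simp_all

lemma iter_log_gt: "iter_exp m s < t \<Longrightarrow> s < iter_log (int m) t"
proof (induction m arbitrary: s)
  case 0
  then show ?case by (simp add: iter_log_def)
next
  case (Suc m)
  then have "exp s < iter_log (int m) t"
    by (metis iter_exp_exp)
  moreover from this have "0 < iter_log (int m) t"
    using exp_gt_zero less_trans by blast
  ultimately have "s < ln (iter_log (int m) t)"
    by (metis exp_less_cancel_iff exp_ln)
  then show ?case
    using iter_log_simps(3)[of "int m" t] by (simp add: add.commute)
qed

definition log_vec :: "int \<Rightarrow> real \<Rightarrow> (int \<Rightarrow> real)" where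
  "log_vec k t = (\<lambda>j\<in>{-1..k}. iter_log j t)"

definition pos_vecs :: "int \<Rightarrow> (int \<Rightarrow> real) set" where
  "pos_vecs k = {-1..k} \<rightarrow>\<^sub>E {0<..}"

definition exponents :: "int \<Rightarrow> (int \<Rightarrow> complex) set" where
  "exponents k = {-1..k} \<rightarrow>\<^sub>E UNIV"

definition vec_powr :: "int \<Rightarrow> (int \<Rightarrow> real) \<Rightarrow> (int \<Rightarrow> complex) \<Rightarrow> complex" where
  "vec_powr k z \<alpha> = (\<Prod>j\<in>{-1..k}. of_real (z j) powr \<alpha> j)"

lemma vec_powr_exp:
  assumes "z \<in> pos_vecs k"
  shows "vec_powr k z \<alpha> = (\<Prod>j\<in>{-1..k}. exp (\<alpha> j * of_real (ln (z j))))"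
  unfolding vec_powr_def
proof (rule prod.cong)
  fix j assume "j \<in> {-1..k}"
  with assms have "z j > 0" by (auto simp: pos_vecs_def PiE_def Pi_def)
  then show "of_real (z j) powr \<alpha> j = exp (\<alpha> j * of_real (ln (z j)))"
    by (simp add: powr_def Ln_of_real)
qed simp

definition exps_C :: "int \<Rightarrow> int \<Rightarrow> real \<Rightarrow> (int \<Rightarrow> complex) set" where
  "exps_C m k \<mu> =
    {\<alpha> \<in> exponents k. (\<forall>j. -1 \<le> j \<and> j < m \<longrightarrow> Re (\<alpha> j) = 0) \<and> Re (\<alpha> m) = \<mu>}"

definition represents ::
    "int \<Rightarrow> ((int \<Rightarrow> real) \<Rightarrow> complex ^ 'n) \<Rightarrow> (int \<Rightarrow> complex) set
      \<Rightarrow> ((int \<Rightarrow> complex) \<Rightarrow> complex ^ 'n) \<Rightarrow> bool" where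
  "represents k p S \<xi> \<longleftrightarrow>
    finite S \<and> S \<subseteq> exponents k \<and>
    (\<forall>z\<in>pos_vecs k. p z = (\<Sum>\<alpha>\<in>S. vec_powr k z \<alpha> *s \<xi> \<alpha>))"

text \<open>Values of \<open>p\<close> outside \<open>pos_vecs k\<close> are unconstrained.\<close>

definition power_sums :: "int \<Rightarrow> int \<Rightarrow> real \<Rightarrow> ((int \<Rightarrow> real) \<Rightarrow> complex ^ 'n) set" where
  "power_sums m k \<mu> = {p. \<exists>S \<xi>. S \<subseteq> exps_C m k \<mu> \<and> represents k p S \<xi>}"

text \<open>
  The operator acts on functions \<open>p\<close>, through any representation whose exponents all satisfy
  \<open>Re (\<alpha> (-1)) = 0\<close>. Lemma \<open>Z_op_eq\<close> shows that its values on \<open>p\<close> do not depend on the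
  representation chosen.
\<close>

definition Z_op ::
    "complex ^ 'n ^ 'n \<Rightarrow> int \<Rightarrow> ((int \<Rightarrow> real) \<Rightarrow> complex ^ 'n) \<Rightarrow> (int \<Rightarrow> real) \<Rightarrow> complex ^ 'n" where
  "Z_op A k p z =
    (let (S, \<xi>) = (SOME (S, \<xi>). represents k p S \<xi> \<and> (\<forall>\<alpha>\<in>S. Re (\<alpha> (-1)) = 0))
     in \<Sum>\<alpha>\<in>S. vec_powr k z \<alpha> *s (matrix_inv (A + mat (\<alpha> (-1))) *v \<xi> \<alpha>))"

definition mat_eigenvalue :: "complex ^ 'n ^ 'n \<Rightarrow> complex \<Rightarrow> bool" where
  "mat_eigenvalue A c \<longleftrightarrow> (\<exists>v. v \<noteq> 0 \<and> A *v v = c *s v)"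

lemma exists_separating_point:
  assumes "\<alpha> \<in> exponents k" "\<beta> \<in> exponents k" "\<alpha> \<noteq> \<beta>"
  shows "\<exists>w\<in>pos_vecs k. vec_powr k w \<alpha> \<noteq> vec_powr k w \<beta>"
proof -
  obtain j where j: "j \<in> {-1..k}" "\<alpha> j \<noteq> \<beta> j"
    using assms unfolding exponents_def by (metis PiE_ext)
  define d where "d = \<alpha> j - \<beta> j"
  define s where "s = 1 / norm d"
  have d: "d \<noteq> 0" using j by (simp add: d_def)
  have s: "s > 0" "norm (d * of_real s) = 1" using d by (simp_all add: s_def norm_mult norm_divide)
  define w where "w = (\<lambda>i\<in>{-1..k}. if i = j then exp s else 1)"
  have w: "w \<in> pos_vecs k" by (auto simp: w_def pos_vecs_def)
  have val: "vec_powr k w \<gamma> = exp (\<gamma> j * of_real s)" for \<gamma>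
  proof -
    have "vec_powr k w \<gamma> = (\<Prod>i\<in>{-1..k}. if i = j then exp (\<gamma> j * of_real s) else 1)"
      unfolding vec_powr_exp[OF w] by (rule prod.cong) (auto simp: w_def)
    then show ?thesis using j by simp
  qed
  have "exp (d * of_real s) \<noteq> 1"
  proof
    assume "exp (d * of_real s) = 1"
    then obtain n :: int where n: "Re (d * of_real s) = 0" "Im (d * of_real s) = of_int (2 * n) * pi"
      by (auto simp only: exp_eq_1)
    then have "norm (d * of_real s) = \<bar>of_int (2 * n) * pi\<bar>"
      unfolding cmod_def n by simp
    with s have e: "\<bar>of_int n\<bar> * (2 * pi) = (1::real)" by (simp add: abs_mult)
    then have "n \<noteq> 0" by auto
    then have "(1::real) \<le> \<bar>of_int n\<bar>" by linarith
    then have "1 * (2 * pi) \<le> \<bar>of_int n\<bar> * (2 * pi)" by (rule mult_right_mono) simp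
    with e pi_gt3 show False by linarith
  qed
  moreover have "exp (d * of_real s) = exp (\<alpha> j * of_real s) / exp (\<beta> j * of_real s)"
    by (simp add: d_def left_diff_distrib exp_diff)
  ultimately have "vec_powr k w \<alpha> \<noteq> vec_powr k w \<beta>" unfolding val by auto
  with w show ?thesis by blast
qed

lemma power_sum_eq_0_imp:
  fixes \<xi> :: "(int \<Rightarrow> complex) \<Rightarrow> complex ^ 'n"
  assumes "finite S" "S \<subseteq> exponents k"
    and "\<And>z. z \<in> pos_vecs k \<Longrightarrow> (\<Sum>\<alpha>\<in>S. vec_powr k z \<alpha> *s \<xi> \<alpha>) = 0"
  shows "\<forall>\<alpha>\<in>S. \<xi> \<alpha> = 0"
  using assms
proof (induction S arbitrary: \<xi> rule: finite_induct)
  case (insert \<beta> S)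
  have S0: "\<forall>\<alpha>\<in>S. \<xi> \<alpha> = 0"
  proof
    fix \<alpha> assume a: "\<alpha> \<in> S"
    then have "\<alpha> \<noteq> \<beta>" using insert by auto
    then obtain w where w: "w \<in> pos_vecs k" "vec_powr k w \<alpha> \<noteq> vec_powr k w \<beta>"
      using exists_separating_point[of \<alpha> k \<beta>] a insert.prems(1) by blast
    have "\<forall>\<alpha>\<in>S. (vec_powr k w \<alpha> - vec_powr k w \<beta>) *s \<xi> \<alpha> = 0"
    proof (rule insert.IH)
      fix z assume z: "z \<in> pos_vecs k"
      define zw where "zw = (\<lambda>j\<in>{-1..k}. z j * w j)"
      have zw: "zw \<in> pos_vecs k"
        using z w by (auto simp: zw_def pos_vecs_def PiE_def Pi_def)
      have mul: "vec_powr k zw \<gamma> = vec_powr k z \<gamma> * vec_powr k w \<gamma>" for \<gamma>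
        unfolding vec_powr_exp[OF zw] vec_powr_exp[OF z] vec_powr_exp[OF w(1)]
          prod.distrib[symmetric]
        using z w
        by (intro prod.cong)
           (auto simp: zw_def pos_vecs_def PiE_def Pi_def ln_mult distrib_left exp_add)
      have "(\<Sum>\<alpha>\<in>S. vec_powr k z \<alpha> *s ((vec_powr k w \<alpha> - vec_powr k w \<beta>) *s \<xi> \<alpha>))
          = (\<Sum>\<alpha>\<in>insert \<beta> S. vec_powr k z \<alpha> *s ((vec_powr k w \<alpha> - vec_powr k w \<beta>) *s \<xi> \<alpha>))"
        using insert by simp
      also have "\<dots> = (\<Sum>\<alpha>\<in>insert \<beta> S. vec_powr k zw \<alpha> *s \<xi> \<alpha>)
          - vec_powr k w \<beta> *s (\<Sum>\<alpha>\<in>insert \<beta> S. vec_powr k z \<alpha> *s \<xi> \<alpha>)"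
        unfolding vec.scale_sum_right sum_subtractf[symmetric]
        by (rule sum.cong) (simp_all add: mul algebra_simps vec_eq_iff)
      also have "\<dots> = 0"
        using insert.prems(2)[OF z] insert.prems(2)[OF zw] by simp
      finally show "(\<Sum>\<alpha>\<in>S. vec_powr k z \<alpha> *s ((vec_powr k w \<alpha> - vec_powr k w \<beta>) *s \<xi> \<alpha>)) = 0" .
    qed (use insert in auto)
    with a w show "\<xi> \<alpha> = 0" by auto
  qed
  define u where "u = (\<lambda>j\<in>{-1..k}. 1::real)"
  have u: "u \<in> pos_vecs k" by (auto simp: u_def pos_vecs_def)
  have "vec_powr k u \<beta> = 1"
    unfolding vec_powr_exp[OF u] by (rule prod.neutral) (auto simp: u_def)
  then have "\<xi> \<beta> = 0"
    using insert.prems(2)[OF u] insert.hyps S0 by simp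
  with S0 show ?case by simp
qed simp

lemma Z_op_eq:
  fixes \<xi> :: "(int \<Rightarrow> complex) \<Rightarrow> complex ^ 'n"
  assumes rep: "represents k p S \<xi>" and re: "\<forall>\<alpha>\<in>S. Re (\<alpha> (-1)) = 0"
  shows "Z_op A k p z = (\<Sum>\<alpha>\<in>S. vec_powr k z \<alpha> *s (matrix_inv (A + mat (\<alpha> (-1))) *v \<xi> \<alpha>))"
proof -
  define P where "P = (\<lambda>(S, \<xi>). represents k p S \<xi> \<and> (\<forall>\<alpha>\<in>S. Re (\<alpha> (-1)) = 0))"
  obtain S' \<xi>' where R: "Eps P = (S', \<xi>')" by (cases "Eps P")
  have "P (Eps P)" using rep re by (intro someI[of P "(S, \<xi>)"]) (simp add: P_def)
  then have rep': "represents k p S' \<xi>'" unfolding R by (simp add: P_def)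
  define U where "U = S \<union> S'"
  define c where "c = (\<lambda>\<alpha>. if \<alpha> \<in> S then \<xi> \<alpha> else 0)"
  define c' where "c' = (\<lambda>\<alpha>. if \<alpha> \<in> S' then \<xi>' \<alpha> else 0)"
  have fin: "finite U" and sub: "U \<subseteq> exponents k"
    using rep rep' by (auto simp: U_def represents_def)
  have ext: "(\<Sum>\<alpha>\<in>S. vec_powr k x \<alpha> *s (M \<alpha> *v \<xi> \<alpha>)) = (\<Sum>\<alpha>\<in>U. vec_powr k x \<alpha> *s (M \<alpha> *v c \<alpha>))"
    for x and M :: "(int \<Rightarrow> complex) \<Rightarrow> complex ^ 'n ^ 'n"
    using fin by (intro sum.mono_neutral_cong_left) (auto simp: U_def c_def)
  have ext': "(\<Sum>\<alpha>\<in>S'. vec_powr k x \<alpha> *s (M \<alpha> *v \<xi>' \<alpha>)) = (\<Sum>\<alpha>\<in>U. vec_powr k x \<alpha> *s (M \<alpha> *v c' \<alpha>))"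
    for x and M :: "(int \<Rightarrow> complex) \<Rightarrow> complex ^ 'n ^ 'n"
    using fin by (intro sum.mono_neutral_cong_left) (auto simp: U_def c'_def)
  have "\<forall>\<alpha>\<in>U. c \<alpha> - c' \<alpha> = 0"
  proof (rule power_sum_eq_0_imp[OF fin sub])
    fix x assume x: "x \<in> pos_vecs k"
    have "(\<Sum>\<alpha>\<in>U. vec_powr k x \<alpha> *s c \<alpha>) = p x" "(\<Sum>\<alpha>\<in>U. vec_powr k x \<alpha> *s c' \<alpha>) = p x"
      using x rep rep' ext[of x "\<lambda>_. mat 1"] ext'[of x "\<lambda>_. mat 1"]
      by (simp_all add: represents_def)
    then show "(\<Sum>\<alpha>\<in>U. vec_powr k x \<alpha> *s (c \<alpha> - c' \<alpha>)) = 0"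
      by (simp add: vec.scale_right_diff_distrib sum_subtractf)
  qed
  then have eq: "c \<alpha> = c' \<alpha>" if "\<alpha> \<in> U" for \<alpha> using that by simp
  have "Z_op A k p z = (\<Sum>\<alpha>\<in>S'. vec_powr k z \<alpha> *s (matrix_inv (A + mat (\<alpha> (-1))) *v \<xi>' \<alpha>))"
    using R by (simp add: Z_op_def P_def)
  also have "\<dots> = (\<Sum>\<alpha>\<in>S. vec_powr k z \<alpha> *s (matrix_inv (A + mat (\<alpha> (-1))) *v \<xi> \<alpha>))"
    unfolding ext ext' using eq by (intro sum.cong) auto
  finally show ?thesis .
qed

end

theory Submission
  imports Defs "HOL-Computational_Algebra.Fundamental_Theorem_Algebra" "HOL-Real_Asymp.Real_Asymp"
begin

text \<open>
  Since the spectrum of \<open>A\<close> lies in the right half plane, there is a Lyapunov form \<open>G\<close> with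
  \<open>G x (A x) \<ge> l G x x\<close>. It can be written down without matrix exponentials: if
  \<open>(A - r\<^sub>n) \<cdots> (A - r\<^sub>1) = 0\<close> with eigenvalues \<open>r\<^sub>i\<close>, a weighted sum of the squared norms of the
  partial products applied to \<open>x\<close> works. It follows that \<open>w' + A w = O(\<phi>)\<close> up to a small multiple of
  \<open>w\<close> forces \<open>w = O(\<phi>)\<close> whenever \<open>\<phi>' = o(\<phi>)\<close>, for instance for powers of iterated logarithms.
  Applied to \<open>y\<close> this gives the decay rate \<open>\<mu> - \<eta>\<close> for small \<open>\<eta>\<close>. The function \<open>Z = Z\<^sub>A p\<close> along
  the iterated logarithms solves \<open>Z' + A Z = p\<close> up to a relative error \<open>O(1 / t)\<close>, because only
  the factor \<open>exp (\<alpha>\<^sub>-\<^sub>1 t)\<close> has a derivative that is not small; so the same estimate applied to \<open>y - Z\<close>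
  yields the claim.
\<close>

section \<open>Complex vectors as a real inner product space\<close>

lemma scaleR_eq_vector_scalar_mult: "r *\<^sub>R x = of_real r *s (x :: complex ^ 'n)"
  by (simp add: vec_eq_iff complex_eq_iff)

lemma matrix_vector_mult_linear_real:
  fixes A :: "complex ^ 'n ^ 'm"
  shows "linear ((*v) A)"
proof (rule linearI)
  fix r :: real and x :: "complex ^ 'n"
  show "A *v (r *\<^sub>R x) = r *\<^sub>R (A *v x)"
    by (simp add: scaleR_eq_vector_scalar_mult vector_scalar_commute)
qed (simp add: vec.add)

lemma bounded_linear_matrix_vector_mult:
  fixes A :: "complex ^ 'n ^ 'm"
  shows "bounded_linear ((*v) A)"
  using matrix_vector_mult_linear_real linear_conv_bounded_linear by blast

lemma norm_vector_scalar_mult: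
  fixes x :: "complex ^ 'n"
  shows "norm (c *s x) = norm c * norm x"
  by (simp add: norm_vec_def norm_mult L2_set_right_distrib)

lemma bounded_bilinear_vector_scalar_mult:
  "bounded_bilinear ((*s) :: complex \<Rightarrow> complex ^ 'n \<Rightarrow> complex ^ 'n)"
proof
  show "\<exists>K. \<forall>a b. norm (a *s b :: complex ^ 'n) \<le> norm a * norm b * K"
    by (rule exI[of _ 1]) (simp add: norm_vector_scalar_mult)
qed (simp_all add: vec_eq_iff algebra_simps complex_eq_iff)

text \<open>The inner product is the real one: an imaginary factor turns each coordinate by a right
  angle, so only the real part of \<open>c\<close> survives.\<close>

lemma inner_vector_scalar_mult_self:
  fixes x :: "complex ^ 'n"
  shows "x \<bullet> (c *s x) = Re c * (x \<bullet> x)"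
proof -
  have "a \<bullet> (c * a) = Re c * (a \<bullet> a)" for a :: complex
    by (simp add: inner_complex_def algebra_simps)
  then show ?thesis
    by (simp add: inner_vec_def sum_distrib_left)
qed

section \<open>An annihilating product of linear factors\<close>

text \<open>This is \<open>p(A) x\<close> by Horner's scheme. Acting on a vector avoids evaluating
  polynomials in a ring of matrices.\<close>

definition poly_apply :: "complex ^ 'n ^ 'n \<Rightarrow> complex poly \<Rightarrow> complex ^ 'n \<Rightarrow> complex ^ 'n" where
  "poly_apply A p x = fold_coeffs (\<lambda>a y. a *s x + A *v y) p 0"

lemma poly_apply_0 [simp]: "poly_apply A 0 x = 0"
  by (simp add: poly_apply_def)

lemma poly_apply_pCons [simp]: "poly_apply A (pCons a p) x = a *s x + A *v poly_apply A p x"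
proof (cases "p = 0 \<and> a = 0")
  case False
  then show ?thesis
    by (auto simp: poly_apply_def)
qed simp

lemma poly_apply_add: "poly_apply A (p + q) x = poly_apply A p x + poly_apply A q x"
  by (induction p q rule: poly_induct2) (simp_all add: vec.add algebra_simps)

lemma poly_apply_smult: "poly_apply A (smult c p) x = c *s poly_apply A p x"
  by (induction p) (simp_all add: vec.add vec.scale_right_distrib vector_scalar_commute)

lemma poly_apply_matrix: "poly_apply A p (A *v x) = A *v poly_apply A p x"
  by (induction p) (simp_all add: vec.add vector_scalar_commute)

lemma poly_apply_scalar: "poly_apply A p (c *s x) = c *s poly_apply A p x"
  by (induction p) (simp_all add: vec.scale_right_distrib vector_scalar_commute mult.commute)

lemma poly_apply_diff: "poly_apply A p (x - y) = poly_apply A p x - poly_apply A p y"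
  by (induction p) (simp_all add: vec.diff vec.scale_right_diff_distrib)

lemma poly_apply_monom: "poly_apply A (monom c i) x = c *s (((*v) A ^^ i) x)"
  by (induction i) (simp_all add: monom_0 monom_Suc vector_scalar_commute)

lemma poly_apply_sum: "poly_apply A (sum P I) x = (\<Sum>i\<in>I. poly_apply A (P i) x)"
  by (induction I rule: infinite_finite_induct) (simp_all add: poly_apply_add)

text \<open>Polynomials in \<open>A\<close> commute with \<open>A\<close>, so a linear factor may
  act first; this is the order in which \<open>linear_factors\<close> consumes its list.\<close>

lemma poly_apply_linear_factor:
  "poly_apply A ([:- r, 1:] * q) x = poly_apply A q (A *v x - r *s x)"
proof -
  have "poly_apply A ([:- r, 1:] * q) x = (- r) *s poly_apply A q x + A *v poly_apply A q x"
    unfolding mult_pCons_left poly_apply_add poly_apply_smult by simp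
  then show ?thesis
    by (simp add: poly_apply_diff poly_apply_matrix poly_apply_scalar)
qed

text \<open>The same factor may act last instead. If the result vanishes,
  \<open>poly_apply A q x\<close> is zero or an eigenvector for \<open>r\<close>.\<close>

lemma poly_apply_linear_factor':
  "poly_apply A q (A *v x - r *s x) = A *v poly_apply A q x - r *s poly_apply A q x"
  by (simp add: poly_apply_diff poly_apply_matrix poly_apply_scalar)

text \<open>Dependence is stated for a sequence because members may coincide; two equal members give
  the coefficients \<open>1\<close> and \<open>-1\<close>.\<close>

lemma dependent_sequence:
  fixes v :: "nat \<Rightarrow> 'a :: euclidean_space"
  obtains c where "(\<Sum>i\<le>DIM('a). c i *\<^sub>R v i) = 0" "\<exists>i\<le>DIM('a). c i \<noteq> 0"
proof (cases "inj_on v {..DIM('a)}")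
  case True
  have "card (v ` {..DIM('a)}) = Suc DIM('a)"
    using True by (simp add: card_image)
  then have "dependent (v ` {..DIM('a)})"
    using independent_bound by fastforce
  then obtain u where u: "\<exists>i\<le>DIM('a). u (v i) \<noteq> 0" "(\<Sum>w\<in>v ` {..DIM('a)}. u w *\<^sub>R w) = 0"
    unfolding dependent_finite[OF finite_imageI[OF finite_atMost]] by auto
  then have "(\<Sum>i\<le>DIM('a). u (v i) *\<^sub>R v i) = 0"
    by (simp add: sum.reindex[OF True])
  with u(1) that[of "\<lambda>i. u (v i)"] show ?thesis by blast
next
  case False
  then obtain i j where ij: "i \<le> DIM('a)" "j \<le> DIM('a)" "i \<noteq> j" "v i = v j"
    by (auto simp: inj_on_def)
  define c where "c = (\<lambda>l. if l = i then 1 else if l = j then -1 else (0::real))"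
  have "(\<Sum>l\<le>DIM('a). c l *\<^sub>R v l) = (\<Sum>l\<in>{i, j}. c l *\<^sub>R v l)"
    using ij by (intro sum.mono_neutral_right) (auto simp: c_def)
  also have "\<dots> = 0"
    using ij by (simp add: c_def)
  finally show ?thesis
    using ij(1) by (intro that[of c]) (auto simp: c_def)
qed

text \<open>The powers of \<open>A\<close> lie in a real space of finite dimension \<open>N\<close>,
  so the first \<open>N + 1\<close> of them are dependent; the coefficients of a dependence are
  those of the polynomial.\<close>

lemma annihilating_poly:
  fixes A :: "complex ^ 'n ^ 'n"
  obtains p where "p \<noteq> 0" "\<And>x. poly_apply A p x = 0"
proof -
  define N where "N = DIM(complex ^ 'n ^ 'n)"
  define P where "P = (\<lambda>i. ((**) A ^^ i) (mat 1))"
  have P: "P i *v x = ((*v) A ^^ i) x" for i x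
    by (induction i) (simp_all add: P_def flip: matrix_vector_mul_assoc)
  obtain c where c: "(\<Sum>i\<le>N. c i *\<^sub>R P i) = 0" "\<exists>i\<le>N. c i \<noteq> 0"
    unfolding N_def using dependent_sequence[of P] by blast
  define p where "p = (\<Sum>i\<le>N. monom (of_real (c i) :: complex) i)"
  have "coeff p j = of_real (c j)" if "j \<le> N" for j
    using that by (simp add: p_def coeff_sum)
  with c(2) have "p \<noteq> 0"
    by (metis coeff_0 of_real_eq_0_iff)
  moreover have "poly_apply A p x = 0" for x
  proof -
    have *: "of_real (c i) *s (P i *v x) = (c i *\<^sub>R P i) *v x" for i
      by (simp add: vec_eq_iff matrix_vector_mult_def scaleR_conv_of_real[where 'a = complex]
          sum_distrib_left mult.assoc)
    have "poly_apply A p x = (\<Sum>i\<le>N. (c i *\<^sub>R P i) *v x)"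
      unfolding p_def poly_apply_sum poly_apply_monom P[symmetric] * ..
    also have "\<dots> = (\<Sum>i\<le>N. c i *\<^sub>R P i) *v x"
      by (induction N) (simp_all add: matrix_vector_mult_add_rdistrib)
    finally show ?thesis
      using c(1) by simp
  qed
  ultimately show ?thesis
    using that by blast
qed

primrec linear_factors :: "complex ^ 'n ^ 'n \<Rightarrow> complex list \<Rightarrow> complex ^ 'n \<Rightarrow> complex ^ 'n" where
  "linear_factors A [] x = x"
| "linear_factors A (r # rs) x = linear_factors A rs (A *v x - r *s x)"

text \<open>A factor at a root that is no eigenvalue is injective, so it can be cancelled.\<close>

lemma eigenvalue_factors_of_poly:
  fixes A :: "complex ^ 'n ^ 'n"
  assumes "p \<noteq> 0"
  shows "\<exists>rs. (\<forall>r\<in>set rs. mat_eigenvalue A r) \<and>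
    (\<forall>x. poly_apply A p x = 0 \<longrightarrow> linear_factors A rs x = 0)"
  using assms
proof (induction "degree p" arbitrary: p)
  case 0
  then obtain c where "p = [:c:]" "c \<noteq> 0"
    by (metis degree_eq_zeroE pCons_0_0)
  \<comment> \<open>A nonzero constant annihilates only the zero vector, and the empty product of
    factors is the identity.\<close>
  then show ?case
    by (intro exI[of _ "[]"]) simp
next
  case (Suc n)
  then have "\<not> constant (poly p)"
    by (simp add: constant_degree)
  then obtain r where "poly p r = 0"
    using fundamental_theorem_of_algebra by blast
  then obtain q where q: "p = [:- r, 1:] * q"
    by (auto simp: poly_eq_0_iff_dvd)
  with Suc have q0: "q \<noteq> 0"
    by auto
  with q Suc(2) have "n = degree q"
    by (simp add: degree_mult_eq del: mult_pCons_left)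
  from Suc(1)[OF this q0] obtain rs where rs: "\<forall>r\<in>set rs. mat_eigenvalue A r"
    "\<And>x. poly_apply A q x = 0 \<Longrightarrow> linear_factors A rs x = 0"
    by blast
  show ?case
  proof (cases "mat_eigenvalue A r")
    case True
    with rs show ?thesis
      unfolding q poly_apply_linear_factor by (intro exI[of _ "r # rs"]) auto
  next
    case False
    then have "poly_apply A q x = 0" if "poly_apply A p x = 0" for x
      using that unfolding q poly_apply_linear_factor poly_apply_linear_factor'
      by (auto simp: mat_eigenvalue_def)
    with rs show ?thesis by blast
  qed
qed

lemma annihilating_eigenvalue_factors:
  fixes A :: "complex ^ 'n ^ 'n"
  obtains rs where "\<And>r. r \<in> set rs \<Longrightarrow> mat_eigenvalue A r" "\<And>x. linear_factors A rs x = 0"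
  by (metis annihilating_poly eigenvalue_factors_of_poly)

section \<open>A Lyapunov form\<close>

text \<open>Unfolded, this is the sum over \<open>i < length rs\<close> of \<open>K^i\<close> times
  the inner product of the images of \<open>x\<close> and \<open>y\<close> under the first
  \<open>i\<close> factors. The image under all factors is left out.\<close>

primrec factor_form ::
    "real \<Rightarrow> complex ^ 'n ^ 'n \<Rightarrow> complex list \<Rightarrow> complex ^ 'n \<Rightarrow> complex ^ 'n \<Rightarrow> real" where
  "factor_form K A [] x y = 0"
| "factor_form K A (r # rs) x y =
    x \<bullet> y + K * factor_form K A rs (A *v x - r *s x) (A *v y - r *s y)"

lemma factor_form_nonneg: "0 \<le> K \<Longrightarrow> 0 \<le> factor_form K A rs x x"
  by (induction rs arbitrary: x) simp_all

lemma factor_form_commute: "factor_form K A rs x y = factor_form K A rs y x"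
  by (induction rs arbitrary: x y) (simp_all add: inner_commute)

lemma bounded_bilinear_add:
  assumes "bounded_bilinear f" "bounded_bilinear g"
  shows "bounded_bilinear (\<lambda>x y. f x y + g x y)"
proof -
  interpret f: bounded_bilinear f by fact
  interpret g: bounded_bilinear g by fact
  obtain K L where K: "\<And>a b. norm (f a b) \<le> norm a * norm b * K"
    and L: "\<And>a b. norm (g a b) \<le> norm a * norm b * L"
    using f.bounded g.bounded by blast
  show ?thesis
  proof
    show "\<exists>K. \<forall>a b. norm (f a b + g a b) \<le> norm a * norm b * K"
    proof (intro exI allI)
      fix a b
      show "norm (f a b + g a b) \<le> norm a * norm b * (K + L)"
        using norm_triangle_mono[OF K[of a b] L[of a b]] by (simp add: distrib_left)
    qed
  qed (simp_all add: f.add_left f.add_right g.add_left g.add_right f.scaleR_left f.scaleR_right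
      g.scaleR_left g.scaleR_right scaleR_add_right)
qed

lemma bounded_bilinear_factor_form: "bounded_bilinear (factor_form K A rs)"
proof (induction rs)
  case Nil
  show ?case
    by standard (auto intro: exI[of _ 0])
next
  case (Cons r rs)
  have lin: "bounded_linear (\<lambda>x. A *v x - r *s x)"
    by (intro bounded_linear_sub bounded_linear_matrix_vector_mult
        bounded_bilinear.bounded_linear_right bounded_bilinear_vector_scalar_mult)
  \<comment> \<open>The weight \<open>K\<close> is moved into the first argument, so that the form
    is a composition of a bilinear map with linear ones.\<close>
  have "bounded_bilinear (\<lambda>x y. factor_form K A rs (K *\<^sub>R (A *v x - r *s x)) (A *v y - r *s y))"
    by (rule bounded_bilinear.comp[OF Cons bounded_linear_compose[OF bounded_linear_scaleR_right lin] lin])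
  then have "bounded_bilinear (\<lambda>x y. K * factor_form K A rs (A *v x - r *s x) (A *v y - r *s y))"
    by (simp add: bounded_bilinear.scaleR_left[OF Cons])
  from bounded_bilinear_add[OF bounded_bilinear_inner this] show ?case
    by (simp add: fun_eq_iff bounded_bilinear_def)
qed

text \<open>
  The cross term \<open>x \<bullet> (A x - r x)\<close> is split by the arithmetic-geometric mean inequality; the
  weight \<open>2 / l\<^sup>2\<close> lets the next level of the form absorb the part with \<open>A x - r x\<close>.
\<close>

lemma factor_form_coercive:
  assumes l: "0 < l" and "\<forall>r\<in>set rs. l \<le> Re r" and "linear_factors A rs x = 0"
  shows "l / 4 * (factor_form (2 / l\<^sup>2) A rs x x + x \<bullet> x) \<le> factor_form (2 / l\<^sup>2) A rs x (A *v x)"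
  using assms(2,3)
proof (induction rs arbitrary: x)
  case (Cons r rs)
  define v where "v = A *v x - r *s x"
  let ?G = "factor_form (2 / l\<^sup>2) A rs"
  \<comment> \<open>Since \<open>A\<close> commutes with \<open>A - r\<close>, the next level of the
    form is again evaluated at a pair \<open>v\<close>, \<open>A v\<close>.\<close>
  have Av: "A *v (A *v x) - r *s (A *v x) = A *v v"
    by (simp add: v_def vec.diff vector_scalar_commute)
  have IH: "l / 4 * (?G v v + v \<bullet> v) \<le> ?G v (A *v v)"
    using Cons by (simp add: v_def)
  have "A *v x = r *s x + v"
    by (simp add: v_def)
  then have "x \<bullet> (A *v x) = Re r * (x \<bullet> x) + x \<bullet> v"
    by (simp add: inner_add_right inner_vector_scalar_mult_self)
  moreover have "l * (x \<bullet> x) \<le> Re r * (x \<bullet> x)"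
    using Cons.prems by (intro mult_right_mono) auto
  moreover have "0 \<le> (l *\<^sub>R x + v) \<bullet> (l *\<^sub>R x + v)"
    by simp
  then have "- (l / 2 * (x \<bullet> x)) - (v \<bullet> v) / (2 * l) \<le> x \<bullet> v"
    using l by (simp add: inner_simps inner_commute field_simps)
  ultimately have "l / 2 * (x \<bullet> x) - (v \<bullet> v) / (2 * l) \<le> x \<bullet> (A *v x)"
    by linarith
  moreover have "2 / l\<^sup>2 * (l / 4 * (?G v v + v \<bullet> v)) \<le> 2 / l\<^sup>2 * ?G v (A *v v)"
    using IH by (intro mult_left_mono) auto
  \<comment> \<open>The extra summand \<open>v \<bullet> v\<close> of the induction hypothesis,
    times the weight, is exactly the loss from the cross term.\<close>
  moreover have "2 / l\<^sup>2 * (l / 4 * (?G v v + v \<bullet> v)) = l / 4 * (2 / l\<^sup>2 * ?G v v) + (v \<bullet> v) / (2 * l)"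
    using l by (simp add: field_simps power2_eq_square)
  ultimately show ?case
    by (simp add: Av flip: v_def) (simp add: algebra_simps)
qed simp

lemma lyapunov_form:
  fixes A :: "complex ^ 'n ^ 'n"
  assumes A: "\<And>c. mat_eigenvalue A c \<Longrightarrow> Re c > 0"
  obtains G l where "bounded_bilinear G" "\<And>x y. G x y = G y x" "\<And>x. x \<bullet> x \<le> G x x"
    "0 < l" "\<And>x. l * G x x \<le> G x (A *v x)"
proof -
  obtain rs where rs: "\<And>r. r \<in> set rs \<Longrightarrow> mat_eigenvalue A r" "\<And>x. linear_factors A rs x = 0"
    using annihilating_eigenvalue_factors[of A] by blast
  \<comment> \<open>The inserted \<open>1\<close> keeps the minimum meaningful for an empty
    list.\<close>
  define l where "l = Min (insert 1 (Re ` set rs))"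
  have l: "0 < l" "\<forall>r\<in>set rs. l \<le> Re r"
    using A rs(1) by (auto simp: l_def Min_gr_iff)
  let ?G = "factor_form (2 / l\<^sup>2) A rs"
  have "x \<bullet> x \<le> ?G x x" for x
  proof (cases rs)
    \<comment> \<open>Without factors the annihilation property itself says
      \<open>x = 0\<close>.\<close>
    case Nil
    then show ?thesis using rs(2)[of x] by simp
  next
    case (Cons r rs')
    then show ?thesis by (simp add: factor_form_nonneg)
  qed
  moreover have "l / 4 * ?G x x \<le> ?G x (A *v x)" for x
  proof -
    have "l / 4 * ?G x x \<le> l / 4 * (?G x x + x \<bullet> x)"
      using l by (intro mult_left_mono) auto
    also have "\<dots> \<le> ?G x (A *v x)"
      using l rs(2) by (rule factor_form_coercive)
    finally show ?thesis .
  qed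
  ultimately show ?thesis
    using l(1) bounded_bilinear_factor_form factor_form_commute
    by (intro that[of ?G "l / 4"]) auto
qed

section \<open>Comparison with slowly varying functions\<close>

text \<open>
  For a Lyapunov form \<open>G\<close> and large \<open>K\<close>, the function \<open>U = G w w - K \<phi>\<^sup>2\<close> satisfies
  \<open>U' \<le> - l U\<close>, so it remains nonpositive.
\<close>

lemma linear_decay:
  fixes A :: "complex ^ 'n ^ 'n"
  assumes A: "\<And>c. mat_eigenvalue A c \<Longrightarrow> Re c > 0"
  shows "\<exists>c>0. \<forall>w w' \<phi> \<phi>' C a. 0 \<le> C \<longrightarrow>
    (\<forall>t\<ge>a. (w has_vector_derivative w' t) (at t) \<and>
      norm (w' t + A *v w t) \<le> c * norm (w t) + C * \<phi> t \<and>
      (\<phi> has_real_derivative \<phi>' t) (at t) \<and> 0 < \<phi> t \<and> \<bar>\<phi>' t\<bar> \<le> c * \<phi> t) \<longrightarrow>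
    (\<exists>K. \<forall>t\<ge>a. norm (w t) \<le> K * \<phi> t)"
proof -
  obtain G l where bil: "bounded_bilinear G" and sym: "\<And>x y. G x y = G y x"
    and pos: "\<And>x. x \<bullet> x \<le> G x x" and l: "0 < l" and coer: "\<And>x. l * G x x \<le> G x (A *v x)"
    using lyapunov_form[OF A] by blast
  interpret G: bounded_bilinear G by fact
  obtain B where B: "0 < B" "\<And>x y. norm (G x y) \<le> norm x * norm y * B"
    using G.pos_bounded by blast
  \<comment> \<open>The bound \<open>l / (4 * B)\<close> lets the perturbation
    \<open>c * norm (w t)\<close> consume at most a quarter of the decay \<open>l * G\<close>; the
    bound \<open>l / 4\<close> keeps \<open>\<phi>\<close> from falling too fast for the
    comparison.\<close>
  define c where "c = min (l / 4) (l / (4 * B))"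
  have c: "0 < c" "c \<le> l / 4" "B * c \<le> l / 4"
    using l B(1) by (auto simp: c_def min_def field_simps)
  show ?thesis
  proof (rule exI[of _ c], intro conjI allI impI)
    show "0 < c" by fact
  next
    fix w w' :: "real \<Rightarrow> complex ^ 'n" and \<phi> \<phi>' :: "real \<Rightarrow> real" and C a :: real
    assume C: "0 \<le> C" and hyps: "\<forall>t\<ge>a. (w has_vector_derivative w' t) (at t) \<and>
      norm (w' t + A *v w t) \<le> c * norm (w t) + C * \<phi> t \<and>
      (\<phi> has_real_derivative \<phi>' t) (at t) \<and> 0 < \<phi> t \<and> \<bar>\<phi>' t\<bar> \<le> c * \<phi> t"
    have w: "\<And>t. a \<le> t \<Longrightarrow> (w has_vector_derivative w' t) (at t)"
      and ineq: "\<And>t. a \<le> t \<Longrightarrow> norm (w' t + A *v w t) \<le> c * norm (w t) + C * \<phi> t"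
      and \<phi>: "\<And>t. a \<le> t \<Longrightarrow> (\<phi> has_real_derivative \<phi>' t) (at t)"
      and \<phi>_pos: "\<And>t. a \<le> t \<Longrightarrow> 0 < \<phi> t" and \<phi>'_le: "\<And>t. a \<le> t \<Longrightarrow> \<bar>\<phi>' t\<bar> \<le> c * \<phi> t"
      using hyps by blast+
    \<comment> \<open>\<open>M\<close> is the coefficient of \<open>\<phi>\<close> squared left
      after completing the square. In \<open>K\<close> the first summand outweighs \<open>M\<close>,
      and the second makes \<open>U a\<close> nonpositive.\<close>
    define M where "M = 2 * B\<^sup>2 * C\<^sup>2 / l"
    define K where "K = 2 * M / l + G (w a) (w a) / (\<phi> a)\<^sup>2"
    have G_nonneg: "0 \<le> G x x" for x
      using pos[of x] inner_ge_zero[of x] by linarith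
    have M: "0 \<le> M"
      using l by (simp add: M_def)
    have K: "0 \<le> K" "2 * M / l \<le> K"
      using l M G_nonneg[of "w a"] by (auto simp: K_def)
    define U where "U = (\<lambda>t. G (w t) (w t) - K * (\<phi> t)\<^sup>2)"
    define U' where "U' = (\<lambda>t. 2 * G (w t) (w' t) - 2 * K * \<phi> t * \<phi>' t)"
    have U: "(U has_real_derivative U' t) (at t)" if t: "a \<le> t" for t
    proof -
      have "((\<lambda>t. G (w t) (w t)) has_real_derivative 2 * G (w t) (w' t)) (at t)"
        using G.has_vector_derivative[OF w[OF t] w[OF t]] sym[of "w' t" "w t"]
        by (simp add: has_real_derivative_iff_has_vector_derivative)
      then show ?thesis
        unfolding U_def U'_def
        by (auto intro!: derivative_eq_intros \<phi>[OF t])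
    qed
    have U'_le: "l * U t + U' t \<le> 0" if t: "a \<le> t" for t
    proof -
      define h where "h = w' t + A *v w t"
      define V where "V = G (w t) (w t)"
      define n where "n = norm (w t)"
      have n: "0 \<le> n" "n\<^sup>2 \<le> V"
        using pos[of "w t"] by (simp_all add: n_def V_def power2_norm_eq_inner)
      have "G (w t) (w' t) = G (w t) h - G (w t) (A *v w t)"
        by (simp add: h_def G.add_right)
      also have "\<dots> \<le> n * norm h * B - l * V"
        using B(2)[of "w t" h] coer[of "w t"] by (simp add: n_def V_def)
      also have "n * norm h * B \<le> n * (c * n + C * \<phi> t) * B"
        using ineq[OF t] n(1) B(1) by (intro mult_right_mono mult_left_mono) (auto simp: n_def h_def)
      also have "\<dots> = (B * c) * n\<^sup>2 + B * C * \<phi> t * n"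
        by (simp add: algebra_simps power2_eq_square)
      also have "(B * c) * n\<^sup>2 \<le> l / 4 * V"
        using n c l by (intro mult_mono) auto
      also have "B * C * \<phi> t * n \<le> l / 4 * n\<^sup>2 + M / 2 * (\<phi> t)\<^sup>2"
      proof -
        have "0 \<le> (l / 2 * n - B * C * \<phi> t)\<^sup>2"
          by simp
        then have "l * (B * C * \<phi> t * n) \<le> (l / 2 * n)\<^sup>2 + (B * C * \<phi> t)\<^sup>2"
          by (simp add: power2_diff mult_ac)
        also have "\<dots> = l * (l / 4 * n\<^sup>2 + M / 2 * (\<phi> t)\<^sup>2)"
          using l by (simp add: M_def power2_eq_square field_simps)
        finally have "l * (B * C * \<phi> t * n) \<le> l * (l / 4 * n\<^sup>2 + M / 2 * (\<phi> t)\<^sup>2)" .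
        then show ?thesis
          using l by simp
      qed
      also have "l / 4 * n\<^sup>2 \<le> l / 4 * V"
        using n l by simp
      finally have 1: "2 * G (w t) (w' t) \<le> M * (\<phi> t)\<^sup>2 - l * V"
        by (simp add: field_simps)
      have "- (\<phi> t * \<phi>' t) \<le> \<phi> t * (c * \<phi> t)"
        using \<phi>_pos[OF t] \<phi>'_le[OF t]
        by (metis abs_le_D2 less_imp_le mult_left_mono mult_minus_right)
      also have "\<dots> \<le> l / 4 * (\<phi> t)\<^sup>2"
        using mult_right_mono[OF c(2), of "(\<phi> t)\<^sup>2"] by (simp add: power2_eq_square mult_ac)
      finally have "K * (- (\<phi> t * \<phi>' t)) \<le> K * (l / 4 * (\<phi> t)\<^sup>2)"
        using K(1) by (rule mult_left_mono)
      moreover have "2 * M \<le> K * l"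
        using K(2) l by (simp add: field_simps)
      then have "2 * M * (\<phi> t)\<^sup>2 \<le> K * l * (\<phi> t)\<^sup>2"
        by (intro mult_right_mono) auto
      ultimately show ?thesis
        using 1 by (simp add: U_def U'_def V_def[symmetric] algebra_simps)
    qed
    have Ua: "U a \<le> 0"
      using \<phi>_pos[of a] l M by (simp add: U_def K_def field_simps)
    have "norm (w t) \<le> sqrt K * \<phi> t" if t: "a \<le> t" for t
    proof -
      \<comment> \<open>With the integrating factor, \<open>U' \<le> - l U\<close> says that
        \<open>exp (l * t) * U t\<close> does not increase.\<close>
      have "exp (l * t) * U t \<le> exp (l * a) * U a"
      proof (rule DERIV_nonpos_imp_nonincreasing[OF t])
        fix s assume s: "a \<le> s" "s \<le> t"
        have "((\<lambda>s. exp (l * s) * U s) has_real_derivative exp (l * s) * (l * U s + U' s)) (at s)"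
          by (rule derivative_eq_intros U[OF s(1)] refl | simp add: algebra_simps)+
        moreover have "exp (l * s) * (l * U s + U' s) \<le> 0"
          using U'_le[OF s(1)] by (simp add: mult_nonneg_nonpos)
        ultimately show "\<exists>y. ((\<lambda>s. exp (l * s) * U s) has_real_derivative y) (at s) \<and> y \<le> 0"
          by blast
      qed
      also have "\<dots> \<le> 0"
        using Ua by (simp add: mult_nonneg_nonpos)
      finally have "U t \<le> 0"
        by (simp add: mult_le_0_iff)
      then have "(norm (w t))\<^sup>2 \<le> K * (\<phi> t)\<^sup>2"
        using pos[of "w t"] by (simp add: U_def power2_norm_eq_inner)
      then have "(norm (w t))\<^sup>2 \<le> (sqrt K * \<phi> t)\<^sup>2"
        using K(1) by (simp add: power_mult_distrib)
      moreover have "0 \<le> sqrt K * \<phi> t"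
        using \<phi>_pos[OF t] K(1) by simp
      ultimately show ?thesis
        by (rule power2_le_imp_le)
    qed
    then show "\<exists>K. \<forall>t\<ge>a. norm (w t) \<le> K * \<phi> t"
      by (intro exI[of _ "sqrt K"]) simp
  qed
qed

section \<open>Iterated logarithms\<close>

text \<open>
  The logarithmic derivative of \<open>iter_log j\<close>. For \<open>j = -1\<close> the product is empty, in agreement with
  \<open>iter_log (-1) = exp\<close>.
\<close>

definition log_rate :: "int \<Rightarrow> real \<Rightarrow> real" where
  "log_rate j t = (\<Prod>i\<in>{0..j}. inverse (iter_log i t))"

text \<open>The recursion extends to level \<open>-1\<close> because \<open>ln (exp t) = t\<close>,
  so inductions can start there.\<close>

lemma iter_log_Suc: "-1 \<le> j \<Longrightarrow> iter_log (j + 1) t = ln (iter_log j t)"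
  using iter_log_simps(3)[of j t] iter_log_simps(1,2)[of t] by (cases "j = -1") auto

lemma eventually_iter_log_ge: "\<forall>\<^sub>F t in at_top. c \<le> iter_log j t"
proof (cases "j < 0")
  case True
  then show ?thesis
    using filterlim_at_top exp_at_top by (auto simp: iter_log_def)
next
  case False
  have "\<forall>\<^sub>F t in at_top. c < iter_log (int (nat j)) t"
    using eventually_gt_at_top[of "iter_exp (nat j) c"] by eventually_elim (rule iter_log_gt)
  with False show ?thesis
    by (auto elim: eventually_mono)
qed

lemma filterlim_iter_log: "filterlim (iter_log j) at_top at_top"
  using eventually_iter_log_ge filterlim_at_top by blast

lemma eventually_iter_logs_ge_1: "\<forall>\<^sub>F t in at_top. \<forall>j\<in>{-1..k}. 1 \<le> iter_log j t"
  by (simp add: eventually_ball_finite_distrib eventually_iter_log_ge)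

lemma log_rate_Suc: "-1 \<le> j \<Longrightarrow> log_rate (j + 1) t = log_rate j t / iter_log (j + 1) t"
proof -
  assume "-1 \<le> j"
  then have "{0..j + 1} = insert (j + 1) {0..j}" by auto
  then show ?thesis by (simp add: log_rate_def field_simps)
qed

text \<open>At level \<open>-1\<close> the function is the identity, with derivative
  \<open>1\<close>. Each further logarithm contributes one reciprocal by the chain rule.\<close>

lemma has_derivative_ln_iter_log:
  assumes "-1 \<le> j" "\<forall>i\<in>{-1..j}. 0 < iter_log i t"
  shows "((\<lambda>t. ln (iter_log j t)) has_real_derivative log_rate j t) (at t)"
  using assms
proof (induction j rule: int_ge_induct)
  case base
  then show ?case by (simp add: iter_log_simps log_rate_def)
next
  case (step j)
  have IH: "((\<lambda>t. ln (iter_log j t)) has_real_derivative log_rate j t) (at t)"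
    using step by simp
  have "0 < ln (iter_log j t)"
    using step by (simp flip: iter_log_Suc)
  from DERIV_chain2[OF DERIV_ln_divide[OF this] IH]
  have "((\<lambda>t. ln (ln (iter_log j t))) has_real_derivative
      log_rate j t / ln (iter_log j t)) (at t)"
    by simp
  then show ?case
    using step(1) by (simp add: iter_log_Suc log_rate_Suc)
qed

text \<open>The product begins with \<open>1 / t\<close>, and every later factor is at most
  \<open>1\<close>.\<close>

lemma log_rate_bounds:
  assumes "0 \<le> j" "\<forall>i\<in>{-1..j}. 1 \<le> iter_log i t"
  shows "0 \<le> log_rate j t \<and> log_rate j t \<le> 1 / t"
  using assms
proof (induction j rule: int_ge_induct)
  case base
  then have "1 \<le> iter_log 0 t" by simp
  then show ?case by (simp add: iter_log_simps log_rate_def inverse_eq_divide)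
next
  case (step j)
  have "0 \<le> log_rate j t" "log_rate j t \<le> 1 / t" "1 \<le> iter_log (j + 1) t"
    using step by auto
  moreover from this have "log_rate j t / iter_log (j + 1) t \<le> log_rate j t / 1"
    by (intro divide_left_mono) auto
  ultimately show ?case
    using step(1) by (simp add: log_rate_Suc)
qed

lemma iter_log_le:
  assumes "0 \<le> j" "\<forall>i\<in>{-1..j}. 1 \<le> iter_log i t"
  shows "iter_log j t \<le> t"
  using assms
proof (induction j rule: int_ge_induct)
  case base
  then show ?case by (simp add: iter_log_simps)
next
  case (step j)
  have "0 < iter_log j t"
    using step by (smt (verit) atLeastAtMost_iff)
  then have "ln (iter_log j t) \<le> iter_log j t"
    using ln_le_minus_one by fastforce
  with step show ?case
    by (auto simp: iter_log_Suc)
qed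

lemma iter_log_powr_mono_bigo:
  "a \<le> b \<Longrightarrow> (\<lambda>t. iter_log j t powr a) \<in> O(\<lambda>t. iter_log j t powr b)"
  by (intro bigoI[of _ 1] eventually_mono[OF eventually_iter_log_ge[of 1 j]]) (simp add: powr_mono)

text \<open>Any power of a logarithm is dominated by every positive power of its argument. In the
  induction the intermediate level may carry exponent \<open>1\<close>, since the hypothesis covers
  all exponents.\<close>

lemma iter_log_powr_bigo_lower:
  assumes "0 \<le> m" "m < j" "0 < \<eta>"
  shows "(\<lambda>t. iter_log j t powr a) \<in> O(\<lambda>t. iter_log m t powr \<eta>)"
  using assms(2,3)
proof (induction j arbitrary: a rule: int_gr_induct)
  have ln_bigo: "(\<lambda>t. iter_log (j + 1) t powr a) \<in> O(\<lambda>t. iter_log j t powr \<eta>)"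
    if "0 \<le> j" "0 < \<eta>" for j a \<eta>
  proof -
    have "(\<lambda>x::real. ln x powr a) \<in> O(\<lambda>x. x powr \<eta>)"
      using that(2) by real_asymp
    from landau_o.big.compose[OF this filterlim_iter_log[of j]] show ?thesis
      using that(1) by (simp add: iter_log_Suc)
  qed
  {
    case base
    then show ?case using ln_bigo[of m] assms(1) by simp
  next
    case (step j)
    have "(\<lambda>t. iter_log (j + 1) t powr a) \<in> O(\<lambda>t. iter_log j t powr 1)"
      using step(1) assms(1) by (intro ln_bigo) auto
    also have "(\<lambda>t. iter_log j t powr 1) \<in> O(\<lambda>t. iter_log m t powr \<eta>)"
      using step by blast
    finally show ?case .
  }
qed

text \<open>Half of \<open>\<eta>\<close> is spent on the new factor and half is left for the
  remaining ones.\<close>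

lemma prod_iter_log_powr_bigo:
  assumes "0 \<le> m" "finite J" "\<And>j. j \<in> J \<Longrightarrow> m < j" "0 < \<eta>"
  shows "(\<lambda>t. \<Prod>j\<in>J. iter_log j t powr a j) \<in> O(\<lambda>t. iter_log m t powr \<eta>)"
  using assms(2-4)
proof (induction J arbitrary: \<eta> rule: finite_induct)
  case empty
  then show ?case
    by (intro bigoI[of _ 1] eventually_mono[OF eventually_iter_log_ge[of 1 m]])
      (simp add: ge_one_powr_ge_zero)
next
  case (insert i J)
  have "(\<lambda>t. iter_log i t powr a i * (\<Prod>j\<in>J. iter_log j t powr a j))
      \<in> O(\<lambda>t. iter_log m t powr (\<eta> / 2) * iter_log m t powr (\<eta> / 2))"
    using insert assms(1) by (intro landau_o.big.mult iter_log_powr_bigo_lower insert.IH) auto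
  then show ?case
    using insert by (simp flip: powr_add)
qed

text \<open>The bounds are assumed on an open half-line because \<open>powr\<close> is rewritten as
  an exponential in a neighbourhood of \<open>t\<close>.\<close>

lemma has_derivative_iter_log_powr:
  assumes "0 \<le> m" "a < t" "\<And>s. a < s \<Longrightarrow> \<forall>i\<in>{-1..m}. 1 \<le> iter_log i s"
  shows "((\<lambda>t. iter_log m t powr \<nu>) has_real_derivative iter_log m t powr \<nu> * (\<nu> * log_rate m t)) (at t)"
proof -
  have *: "iter_log m s powr \<nu> = exp (\<nu> * ln (iter_log m s))" if "a < s" for s
  proof -
    have "1 \<le> iter_log m s"
      using assms(1) assms(3)[OF that] by simp
    then show ?thesis
      by (simp add: powr_def)
  qed
  have "((\<lambda>s. ln (iter_log m s)) has_real_derivative log_rate m t) (at t)"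
    using assms(1) assms(3)[OF assms(2)]
    by (intro has_derivative_ln_iter_log) (auto intro: less_le_trans[OF zero_less_one])
  then have "((\<lambda>s. exp (\<nu> * ln (iter_log m s))) has_real_derivative
      exp (\<nu> * ln (iter_log m t)) * (\<nu> * log_rate m t)) (at t)"
    by (intro DERIV_fun_exp DERIV_cmult)
  then have "((\<lambda>s. exp (\<nu> * ln (iter_log m s))) has_real_derivative
      iter_log m t powr \<nu> * (\<nu> * log_rate m t)) (at t)"
    by (simp add: *[OF assms(2)])
  then show ?thesis
    by (rule has_field_derivative_transform_within_open[of _ _ _ "{a<..}"]) (use assms * in auto)
qed

text \<open>The logarithmic derivative of the comparison function is at most
  \<open>\<bar>\<nu>\<bar> / t\<close>, hence eventually below any constant. The inequality is
  demanded for all \<open>c\<close> since the admissible one depends on \<open>A\<close>.\<close>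

lemma linear_decay_iter_log:
  fixes A :: "complex ^ 'n ^ 'n"
  assumes A: "\<And>c. mat_eigenvalue A c \<Longrightarrow> Re c > 0" and m: "0 \<le> m"
    and w: "\<forall>\<^sub>F t in at_top. (w has_vector_derivative w' t) (at t)"
    and ineq: "\<And>c. 0 < c \<Longrightarrow> \<exists>C\<ge>0. \<forall>\<^sub>F t in at_top.
      norm (w' t + A *v w t) \<le> c * norm (w t) + C * iter_log m t powr \<nu>"
  shows "(\<lambda>t. norm (w t)) \<in> O(\<lambda>t. iter_log m t powr \<nu>)"
proof -
  have "\<exists>c>0. \<forall>w w' \<phi> \<phi>' C a. 0 \<le> C \<longrightarrow>
    (\<forall>t\<ge>a. (w has_vector_derivative w' t) (at t) \<and>
      norm (w' t + A *v w t) \<le> c * norm (w t) + C * \<phi> t \<and>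
      (\<phi> has_real_derivative \<phi>' t) (at t) \<and> 0 < \<phi> t \<and> \<bar>\<phi>' t\<bar> \<le> c * \<phi> t) \<longrightarrow>
    (\<exists>K. \<forall>t\<ge>a. norm (w t) \<le> K * \<phi> t)" (is "\<exists>c>0. ?decay c")
    by (rule linear_decay) (rule A)
  then obtain c where c: "0 < c" and decay: "?decay c"
    by (elim exE conjE) (rule that)
  obtain C where C: "0 \<le> C" "\<forall>\<^sub>F t in at_top.
      norm (w' t + A *v w t) \<le> c * norm (w t) + C * iter_log m t powr \<nu>"
    using ineq[OF c] by blast
  have "\<forall>\<^sub>F t in at_top. (w has_vector_derivative w' t) (at t) \<and>
      norm (w' t + A *v w t) \<le> c * norm (w t) + C * iter_log m t powr \<nu> \<and>
      (\<forall>j\<in>{-1..m}. 1 \<le> iter_log j t) \<and> \<bar>\<nu>\<bar> / c \<le> t \<and> 0 < t"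
    by (intro eventually_conj w C(2) eventually_iter_logs_ge_1 eventually_ge_at_top eventually_gt_at_top)
  then obtain a where a: "\<And>t. a \<le> t \<Longrightarrow> (w has_vector_derivative w' t) (at t)"
    "\<And>t. a \<le> t \<Longrightarrow> norm (w' t + A *v w t) \<le> c * norm (w t) + C * iter_log m t powr \<nu>"
    "\<And>t. a \<le> t \<Longrightarrow> \<forall>j\<in>{-1..m}. 1 \<le> iter_log j t" "\<And>t. a \<le> t \<Longrightarrow> \<bar>\<nu>\<bar> / c \<le> t \<and> 0 < t"
    unfolding eventually_at_top_linorder by metis
  \<comment> \<open>The shift to \<open>a + 1\<close> leaves room for the open half-line on which
    the derivative of the power is computed.\<close>
  have "\<exists>K. \<forall>t\<ge>a + 1. norm (w t) \<le> K * iter_log m t powr \<nu>"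
  proof (rule decay[THEN spec[of _ w], THEN spec[of _ w'], THEN spec[of _ "\<lambda>t. iter_log m t powr \<nu>"],
        THEN spec[of _ "\<lambda>t. iter_log m t powr \<nu> * (\<nu> * log_rate m t)"], THEN spec[of _ C],
        THEN spec[of _ "a + 1"], THEN mp, OF C(1), THEN mp], intro allI impI conjI)
    fix t assume t: "a + 1 \<le> t"
    show "(w has_vector_derivative w' t) (at t)"
      "norm (w' t + A *v w t) \<le> c * norm (w t) + C * iter_log m t powr \<nu>"
      using a t by auto
    show "((\<lambda>t. iter_log m t powr \<nu>) has_real_derivative
        iter_log m t powr \<nu> * (\<nu> * log_rate m t)) (at t)"
      using a(3) m t by (intro has_derivative_iter_log_powr[of m a]) auto
    have ge: "\<forall>j\<in>{-1..m}. 1 \<le> iter_log j t"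
      using a(3) t by simp
    with m have "1 \<le> iter_log m t"
      by simp
    then show "0 < iter_log m t powr \<nu>"
      by simp
    have "\<bar>\<nu> * log_rate m t\<bar> \<le> \<bar>\<nu>\<bar> * (1 / t)"
      unfolding abs_mult using log_rate_bounds[OF m ge] by (intro mult_left_mono) auto
    also have "\<dots> \<le> c"
      using a(4)[of t] t c by (simp add: field_simps)
    finally show "\<bar>iter_log m t powr \<nu> * (\<nu> * log_rate m t)\<bar> \<le> c * iter_log m t powr \<nu>"
      by (simp add: abs_mult mult.commute[of c] mult_left_mono)
  qed
  then obtain K where "\<And>t. a + 1 \<le> t \<Longrightarrow> norm (w t) \<le> K * iter_log m t powr \<nu>"
    by blast
  then show ?thesis
    by (intro bigoI[of _ K] eventually_at_top_linorderI[of "a + 1"]) simp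
qed

section \<open>Power sums along iterated logarithms\<close>

lemma log_vec_in_pos_vecs: "\<forall>j\<in>{-1..k}. 1 \<le> iter_log j t \<Longrightarrow> log_vec k t \<in> pos_vecs k"
  by (auto simp: log_vec_def pos_vecs_def intro: less_le_trans[OF zero_less_one])

text \<open>As a single exponential, the monomial is differentiated by differentiating its
  exponent.\<close>

lemma vec_powr_log_vec:
  assumes "\<forall>j\<in>{-1..k}. 1 \<le> iter_log j t"
  shows "vec_powr k (log_vec k t) \<alpha> = exp (\<Sum>j\<in>{-1..k}. \<alpha> j * of_real (ln (iter_log j t)))"
  unfolding vec_powr_exp[OF log_vec_in_pos_vecs[OF assms]] exp_sum[OF finite_atLeastAtMost_int]
  by (rule prod.cong) (simp_all add: log_vec_def)

text \<open>The small part of the logarithmic derivative: the index \<open>-1\<close>, where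
  \<open>log_rate\<close> is \<open>1\<close>, contributes \<open>\<alpha> (-1)\<close> and is kept
  apart.\<close>

definition vec_powr_remainder :: "int \<Rightarrow> (int \<Rightarrow> complex) \<Rightarrow> real \<Rightarrow> complex" where
  "vec_powr_remainder k \<alpha> t = (\<Sum>j\<in>{0..k}. \<alpha> j * of_real (log_rate j t))"

lemma has_derivative_vec_powr_log_vec:
  assumes "-1 \<le> k"
  shows "\<forall>\<^sub>F t in at_top. ((\<lambda>t. vec_powr k (log_vec k t) \<alpha>) has_vector_derivative
    vec_powr k (log_vec k t) \<alpha> * (\<alpha> (-1) + vec_powr_remainder k \<alpha> t)) (at t)"
proof -
  obtain a where a: "\<And>t. a \<le> t \<Longrightarrow> \<forall>j\<in>{-1..k}. 1 \<le> iter_log j t"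
    using eventually_iter_logs_ge_1[of k] unfolding eventually_at_top_linorder by blast
  have "((\<lambda>t. vec_powr k (log_vec k t) \<alpha>) has_vector_derivative
    vec_powr k (log_vec k t) \<alpha> * (\<alpha> (-1) + vec_powr_remainder k \<alpha> t)) (at t)" if t: "a < t" for t
  proof -
    define E where "E = (\<lambda>s. \<Sum>j\<in>{-1..k}. \<alpha> j * of_real (ln (iter_log j s)))"
    have "\<forall>i\<in>{-1..k}. 0 < iter_log i t"
      using a[of t] t by (auto intro: less_le_trans[OF zero_less_one])
    then have "((\<lambda>s. ln (iter_log j s)) has_real_derivative log_rate j t) (at t)"
      if "j \<in> {-1..k}" for j
      using that by (intro has_derivative_ln_iter_log) auto
    then have "(E has_vector_derivative (\<Sum>j\<in>{-1..k}. \<alpha> j * of_real (log_rate j t))) (at t)"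
      unfolding E_def
      by (intro has_vector_derivative_sum has_vector_derivative_mult_right
          has_vector_derivative_of_real)
        (simp flip: has_real_derivative_iff_has_vector_derivative)
    also have "{-1..k} = insert (-1) {0..k}"
      using assms by auto
    finally have "(E has_vector_derivative (\<alpha> (-1) + vec_powr_remainder k \<alpha> t)) (at t)"
      by (simp add: vec_powr_remainder_def log_rate_def)
    from field_vector_diff_chain_at[OF this DERIV_exp]
    have exp_E: "((\<lambda>s. exp (E s)) has_vector_derivative
        exp (E t) * (\<alpha> (-1) + vec_powr_remainder k \<alpha> t)) (at t)"
      by (simp add: o_def mult.commute)
    have eq: "vec_powr k (log_vec k s) \<alpha> = exp (E s)" if "a < s" for s
      using a[of s] that by (simp add: vec_powr_log_vec E_def)
    show ?thesis
      unfolding eq[OF t]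
      by (rule has_vector_derivative_transform_within_open[OF exp_E, of "{a<..}"]) (use t eq in auto)
  qed
  then show ?thesis
    by (rule eventually_mono[OF eventually_gt_at_top])
qed

text \<open>Every rate is at most \<open>1 / t\<close>, hence at most
  \<open>1 / iter_log m t\<close>, which is the scale of the other estimates.\<close>

lemma vec_powr_remainder_bigo:
  assumes "0 \<le> m" "m \<le> k"
  shows "(\<lambda>t. norm (vec_powr_remainder k \<alpha> t)) \<in> O(\<lambda>t. iter_log m t powr -1)"
proof (rule bigoI[of _ "\<Sum>j\<in>{0..k}. norm (\<alpha> j)"])
  show "\<forall>\<^sub>F t in at_top. norm (norm (vec_powr_remainder k \<alpha> t))
      \<le> (\<Sum>j\<in>{0..k}. norm (\<alpha> j)) * norm (iter_log m t powr -1)"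
    using eventually_iter_logs_ge_1[of k] eventually_gt_at_top[of 0]
  proof eventually_elim
    case (elim t)
    have ge: "1 \<le> iter_log m t" "iter_log m t \<le> t"
      using elim assms by (auto intro: iter_log_le)
    have "norm (vec_powr_remainder k \<alpha> t) \<le> (\<Sum>j\<in>{0..k}. norm (\<alpha> j) * (1 / iter_log m t))"
      unfolding vec_powr_remainder_def
    proof (rule sum_norm_le)
      fix j assume "j \<in> {0..k}"
      then have "0 \<le> log_rate j t" "log_rate j t \<le> 1 / t"
        using log_rate_bounds[of j t] elim by auto
      moreover have "1 / t \<le> 1 / iter_log m t"
        using ge by (intro divide_left_mono) auto
      ultimately show "norm (\<alpha> j * of_real (log_rate j t)) \<le> norm (\<alpha> j) * (1 / iter_log m t)"
        unfolding norm_mult by (intro mult_left_mono) auto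
    qed
    then show ?case
      using ge by (simp add: powr_minus_divide sum_divide_distrib)
  qed
qed

text \<open>Factors below level \<open>m\<close> have modulus \<open>1\<close>, level
  \<open>m\<close> gives the power \<open>\<mu>\<close>, and all higher levels together cost at most
  \<open>\<eta>\<close>.\<close>

lemma vec_powr_bigo:
  assumes "0 \<le> m" "m \<le> k" "\<alpha> \<in> exps_C m k \<mu>" "0 < \<eta>"
  shows "(\<lambda>t. norm (vec_powr k (log_vec k t) \<alpha>)) \<in> O(\<lambda>t. iter_log m t powr (\<mu> + \<eta>))"
proof -
  have "norm (vec_powr k (log_vec k t) \<alpha>)
      = iter_log m t powr \<mu> * (\<Prod>j\<in>{m<..k}. iter_log j t powr Re (\<alpha> j))"
    if t: "\<forall>j\<in>{-1..k}. 1 \<le> iter_log j t" for t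
  proof -
    have "norm (vec_powr k (log_vec k t) \<alpha>) = (\<Prod>j\<in>{-1..k}. norm (of_real (iter_log j t) powr \<alpha> j))"
      unfolding vec_powr_def prod_norm[symmetric] by (rule prod.cong) (auto simp: log_vec_def)
    also have "\<dots> = (\<Prod>j\<in>{-1..k}. iter_log j t powr Re (\<alpha> j))"
      using t by (intro prod.cong refl, subst norm_powr_real_powr) (auto intro: order_trans[OF zero_le_one])
    also have "\<dots> = (\<Prod>j\<in>{m..k}. iter_log j t powr Re (\<alpha> j))"
      using assms t by (intro prod.mono_neutral_right) (fastforce simp: exps_C_def)+
    also have "{m..k} = insert m {m<..k}"
      using assms by auto
    finally show ?thesis
      using assms by (simp add: exps_C_def)
  qed
  then have "\<forall>\<^sub>F t in at_top. norm (vec_powr k (log_vec k t) \<alpha>)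
      = iter_log m t powr \<mu> * (\<Prod>j\<in>{m<..k}. iter_log j t powr Re (\<alpha> j))"
    by (rule eventually_mono[OF eventually_iter_logs_ge_1])
  moreover have "(\<lambda>t. iter_log m t powr \<mu> * (\<Prod>j\<in>{m<..k}. iter_log j t powr Re (\<alpha> j)))
      \<in> O(\<lambda>t. iter_log m t powr \<mu> * iter_log m t powr \<eta>)"
    using assms by (intro landau_o.big.mult prod_iter_log_powr_bigo) auto
  ultimately show ?thesis
    by (simp add: landau_o.big.in_cong powr_add)
qed

section \<open>Bounds for sums, the resolvent, and the nonlinearity near zero\<close>

lemma norm_sum_bigo:
  fixes f :: "'i \<Rightarrow> 'a \<Rightarrow> 'b :: real_normed_vector" and g :: "'a \<Rightarrow> real"
  assumes "\<And>i. i \<in> I \<Longrightarrow> (\<lambda>t. norm (f i t)) \<in> O[F](g)"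
  shows "(\<lambda>t. norm (\<Sum>i\<in>I. f i t)) \<in> O[F](g)"
proof -
  have "(\<lambda>t. norm (\<Sum>i\<in>I. f i t)) \<in> O[F](\<lambda>t. \<Sum>i\<in>I. norm (f i t))"
    by (intro bigoI[of _ 1] always_eventually allI) (simp add: norm_sum order_trans[OF norm_sum abs_ge_self])
  also have "(\<lambda>t. \<Sum>i\<in>I. norm (f i t)) \<in> O[F](g)"
    using assms by (rule big_sum_in_bigo)
  finally show ?thesis .
qed

lemma norm_add_bigo:
  fixes f h :: "'a \<Rightarrow> 'b :: real_normed_vector" and g :: "'a \<Rightarrow> real"
  assumes "(\<lambda>t. norm (f t)) \<in> O[F](g)" "(\<lambda>t. norm (h t)) \<in> O[F](g)"
  shows "(\<lambda>t. norm (f t + h t)) \<in> O[F](g)"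
proof -
  have "(\<lambda>t. norm (f t + h t)) \<in> O[F](\<lambda>t. norm (f t) + norm (h t))"
    by (intro bigoI[of _ 1] always_eventually allI) (simp add: norm_triangle_ineq)
  also have "(\<lambda>t. norm (f t) + norm (h t)) \<in> O[F](g)"
    using assms by (rule sum_in_bigo)
  finally show ?thesis .
qed

lemma mat_vector_mult: "mat c *v x = c *s (x :: complex ^ 'n)"
  by (simp add: vec_eq_iff matrix_vector_mult_def mat_def if_distrib[of "\<lambda>a. a * _"] cong: if_cong)

text \<open>A nonzero kernel vector of \<open>A + mat c\<close> would be an eigenvector of
  \<open>A\<close> for \<open>- c\<close>; a square matrix with trivial kernel is
  invertible.\<close>

lemma resolvent_mult:
  fixes A :: "complex ^ 'n ^ 'n"
  assumes "\<not> mat_eigenvalue A (- c)"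
  shows "A *v (matrix_inv (A + mat c) *v x) + c *s (matrix_inv (A + mat c) *v x) = x"
proof -
  have "v = 0" if "(A + mat c) *v v = 0" for v
  proof -
    have "A *v v = (- c) *s v"
      using that by (simp add: matrix_vector_mult_add_rdistrib mat_vector_mult eq_neg_iff_add_eq_0)
    with assms show ?thesis
      by (auto simp: mat_eigenvalue_def)
  qed
  then have "invertible (A + mat c)"
    using invertible_left_inverse matrix_left_invertible_ker by blast
  then have "(A + mat c) ** matrix_inv (A + mat c) = mat 1"
    unfolding matrix_inv_def invertible_def by (rule someI2_ex) simp
  then have "(A + mat c) *v (matrix_inv (A + mat c) *v x) = x"
    by (simp add: matrix_vector_mul_assoc)
  then show ?thesis
    by (simp add: matrix_vector_mult_add_rdistrib mat_vector_mult)
qed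

text \<open>The growth bound says nothing at the point zero, which the solution may hit. Continuity
  forces \<open>F 0 = 0\<close>, so the bound holds on a full neighbourhood.\<close>

lemma superlinear_bound_at_0:
  fixes F :: "complex ^ 'n \<Rightarrow> complex ^ 'n"
  assumes "continuous_on UNIV F" "1 < \<beta>"
    and bigo: "(\<lambda>x. norm (F x)) \<in> O[at 0](\<lambda>x. norm x powr \<beta>)"
  obtains K where "0 < K" "\<forall>\<^sub>F x in nhds 0. norm (F x) \<le> K * norm x powr \<beta>"
proof -
  obtain K where K: "0 < K" "\<forall>\<^sub>F x in at 0. norm (F x) \<le> K * norm x powr \<beta>"
    using landau_o.bigE[OF bigo] by auto
  have "(F \<longlongrightarrow> F 0) (at 0)"
    using assms(1) by (simp add: continuous_on_eq_continuous_at isCont_def)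
  moreover have "((\<lambda>x :: complex ^ 'n. norm x powr \<beta>) \<longlongrightarrow> 0 powr \<beta>) (at 0)"
    using assms(2) by (intro tendsto_powr' tendsto_norm_zero tendsto_ident_at tendsto_const) auto
  then have "((\<lambda>x :: complex ^ 'n. K * norm x powr \<beta>) \<longlongrightarrow> 0) (at 0)"
    by (simp add: tendsto_mult_right_zero)
  then have "(F \<longlongrightarrow> 0) (at 0)"
    using K(2) by (intro Lim_null_comparison[of F]) auto
  ultimately have "F 0 = 0"
    using tendsto_unique by (metis at_neq_bot)
  with K have "\<forall>\<^sub>F x in nhds 0. norm (F x) \<le> K * norm x powr \<beta>"
    by (simp add: eventually_nhds_conv_at)
  with K(1) that show ?thesis by blast
qed

section \<open>The asymptotic expansion\<close>

theorem theorem5p2: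
  fixes A :: "complex ^ 'n ^ 'n"
    and F :: "complex ^ 'n \<Rightarrow> complex ^ 'n"
    and f :: "real \<Rightarrow> complex ^ 'n"
    and p :: "(int \<Rightarrow> real) \<Rightarrow> complex ^ 'n"
    and y y' :: "real \<Rightarrow> complex ^ 'n"
    and m k :: int
    and \<beta> \<mu> \<delta>\<^sub>0 T T\<^sub>0 :: real
  assumes A: "\<And>c. mat_eigenvalue A c \<Longrightarrow> Re c > 0"
    and F_cont: "continuous_on UNIV F"
    and beta: "\<beta> > 1"
    and F_bigo: "(\<lambda>x. norm (F x)) \<in> O[at 0](\<lambda>x. norm x powr \<beta>)"
    and T: "T \<ge> 0"
    and f_cont: "continuous_on {T..} f"
    and m: "0 \<le> m" and mk: "m \<le> k"
    and mu: "\<mu> > 0"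
    and p: "p \<in> power_sums m k (-\<mu>)"
    and delta: "\<delta>\<^sub>0 > 0"
    and f_asymp: "(\<lambda>t. norm (f t - p (log_vec k t))) \<in> O[at_top](\<lambda>t. iter_log m t powr (-\<mu> - \<delta>\<^sub>0))"
    and T0: "T\<^sub>0 > 0" "T\<^sub>0 \<ge> T"
    and y_deriv: "\<And>t. t \<ge> T\<^sub>0 \<Longrightarrow> (y has_vector_derivative y' t) (at t within {T\<^sub>0..})"
    and y'_cont: "continuous_on {T\<^sub>0..} y'"
    and ode: "\<And>t. t > T\<^sub>0 \<Longrightarrow> y' t + A *v y t = F (y t) + f t"
    and y_lim: "(y \<longlongrightarrow> 0) at_top"
  shows "\<exists>\<epsilon>>0. (\<lambda>t. norm (y t - Z_op A k p (log_vec k t))) \<in> O[at_top](\<lambda>t. iter_log m t powr (-\<mu> - \<epsilon>))"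
proof -
  \<comment> \<open>The loss \<open>\<eta>\<close> in the rate absorbs the higher logarithms of \<open>p\<close>; since
    \<open>\<beta> (\<mu> - \<eta>) > \<mu>\<close>, the nonlinearity \<open>F (y t)\<close> still beats the rate \<open>\<mu>\<close>.\<close>
  define \<phi> where "\<phi> = (\<lambda>\<nu> t. iter_log m t powr \<nu>)"
  define \<eta> where "\<eta> = min (1 / 2) (\<mu> * (\<beta> - 1) / (2 * \<beta>))"
  \<comment> \<open>The three bounds serve \<open>f - p\<close>, the remainder \<open>R\<close>
    (where \<open>\<eta> + \<epsilon> \<le> 1\<close> is required) and \<open>F (y t)\<close> (where
    \<open>\<eta> * \<beta> + \<epsilon> \<le> \<mu> * (\<beta> - 1)\<close> is required).\<close>
  define \<epsilon> where "\<epsilon> = min \<delta>\<^sub>0 (min (1 / 2) (\<mu> * (\<beta> - 1) / 2))"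
  have \<eta>: "0 < \<eta>" "\<eta> \<le> 1 / 2" "\<eta> * \<beta> \<le> \<mu> * (\<beta> - 1) / 2"
    using mu beta by (auto simp: \<eta>_def min_def field_simps)
  have \<epsilon>: "0 < \<epsilon>" "\<epsilon> \<le> \<delta>\<^sub>0" "\<epsilon> \<le> 1 / 2" "\<epsilon> \<le> \<mu> * (\<beta> - 1) / 2"
    using mu beta delta by (auto simp: \<epsilon>_def)
  have \<phi>_mono: "\<phi> a \<in> O(\<phi> b)" if "a \<le> b" for a b
    unfolding \<phi>_def using that by (rule iter_log_powr_mono_bigo)
  obtain S \<xi> where S: "S \<subseteq> exps_C m k (- \<mu>)" and rep: "represents k p S \<xi>"
    using p by (auto simp: power_sums_def)
  have S_re: "\<forall>\<alpha>\<in>S. Re (\<alpha> (-1)) = 0"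
    using S m by (auto simp: exps_C_def)
  have "finite S"
    using rep by (simp add: represents_def)
  define h where "h = (\<lambda>\<alpha> t. vec_powr k (log_vec k t) \<alpha>)"
  define \<zeta> where "\<zeta> = (\<lambda>\<alpha>. matrix_inv (A + mat (\<alpha> (-1))) *v \<xi> \<alpha>)"
  define Z where "Z = (\<lambda>t. Z_op A k p (log_vec k t))"
  define R where "R = (\<lambda>t. \<Sum>\<alpha>\<in>S. (h \<alpha> t * vec_powr_remainder k \<alpha> t) *s \<zeta> \<alpha>)"
  define Z' where "Z' = (\<lambda>t. \<Sum>\<alpha>\<in>S. (h \<alpha> t * (\<alpha> (-1) + vec_powr_remainder k \<alpha> t)) *s \<zeta> \<alpha>)"
  \<comment> \<open>\<open>Z_op\<close> chooses some representation of \<open>p\<close>, but its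
    value is the same for \<open>S\<close> and \<open>\<xi>\<close>.\<close>
  have Z: "Z = (\<lambda>t. \<Sum>\<alpha>\<in>S. h \<alpha> t *s \<zeta> \<alpha>)"
    unfolding Z_def h_def \<zeta>_def Z_op_eq[OF rep S_re] ..
  have Z_deriv: "\<forall>\<^sub>F t in at_top. (Z has_vector_derivative Z' t) (at t)"
  proof -
    have "\<forall>\<^sub>F t in at_top. \<forall>\<alpha>\<in>S.
        (h \<alpha> has_vector_derivative h \<alpha> t * (\<alpha> (-1) + vec_powr_remainder k \<alpha> t)) (at t)"
      unfolding h_def using m mk \<open>finite S\<close>
      by (intro eventually_ball_finite ballI has_derivative_vec_powr_log_vec) auto
    then show ?thesis
    proof eventually_elim
      case (elim t)
      have "((\<lambda>t. h \<alpha> t *s \<zeta> \<alpha>) has_vector_derivative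
          (h \<alpha> t * (\<alpha> (-1) + vec_powr_remainder k \<alpha> t)) *s \<zeta> \<alpha>) (at t)" if "\<alpha> \<in> S" for \<alpha>
        using bounded_linear.has_vector_derivative[OF bounded_bilinear.bounded_linear_left[OF
              bounded_bilinear_vector_scalar_mult] elim[rule_format, OF that]] .
      then show ?case
        unfolding Z Z'_def by (rule has_vector_derivative_sum)
    qed
  qed
  have p_eq: "\<forall>\<^sub>F t in at_top. p (log_vec k t) = (\<Sum>\<alpha>\<in>S. h \<alpha> t *s \<xi> \<alpha>)"
    using eventually_iter_logs_ge_1[of k]
    by eventually_elim (use rep log_vec_in_pos_vecs in \<open>auto simp: represents_def h_def\<close>)
  have Z_ode: "\<forall>\<^sub>F t in at_top. Z' t + A *v Z t = p (log_vec k t) + R t"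
    using p_eq
  proof eventually_elim
    case (elim t)
    \<comment> \<open>\<open>- \<alpha> (-1)\<close> is purely imaginary, hence no eigenvalue of
      \<open>A\<close>.\<close>
    have resolvent: "A *v \<zeta> \<alpha> + \<alpha> (-1) *s \<zeta> \<alpha> = \<xi> \<alpha>" if "\<alpha> \<in> S" for \<alpha>
      unfolding \<zeta>_def by (rule resolvent_mult) (use A S_re that in fastforce)
    have "Z' t + A *v Z t
        = (\<Sum>\<alpha>\<in>S. h \<alpha> t *s (A *v \<zeta> \<alpha> + \<alpha> (-1) *s \<zeta> \<alpha>) + (h \<alpha> t * vec_powr_remainder k \<alpha> t) *s \<zeta> \<alpha>)"
      unfolding Z Z'_def vec.sum sum.distrib[symmetric]
      by (rule sum.cong) (simp_all add: vector_scalar_commute vec.scale_right_distrib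
          vec.scale_left_distrib distrib_left)
    also have "\<dots> = (\<Sum>\<alpha>\<in>S. h \<alpha> t *s \<xi> \<alpha>) + R t"
      by (simp add: sum.distrib R_def resolvent)
    finally show ?case
      using elim by simp
  qed
  have h_bigo: "(\<lambda>t. norm (h \<alpha> t)) \<in> O(\<phi> (- \<mu> + \<eta>))" if "\<alpha> \<in> S" for \<alpha>
    unfolding h_def \<phi>_def using m mk S that \<eta>(1) by (intro vec_powr_bigo) auto
  have R_bigo: "(\<lambda>t. norm (R t)) \<in> O(\<phi> (- \<mu> - \<epsilon>))"
  proof -
    have prod: "(\<lambda>t. \<phi> (- \<mu> + \<eta>) t * \<phi> (- 1) t) = \<phi> (- \<mu> + \<eta> - 1)"
      by (simp only: \<phi>_def powr_add[symmetric] diff_conv_add_uminus)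
    have "\<phi> (- \<mu> + \<eta> - 1) \<in> O(\<phi> (- \<mu> - \<epsilon>))"
      using \<eta> \<epsilon> by (intro \<phi>_mono) auto
    moreover have "(\<lambda>t. norm (h \<alpha> t) * norm (vec_powr_remainder k \<alpha> t)) \<in> O(\<phi> (- \<mu> + \<eta> - 1))"
      if "\<alpha> \<in> S" for \<alpha>
      using h_bigo[OF that] vec_powr_remainder_bigo[OF m mk, of \<alpha>]
      unfolding prod[symmetric] unfolding \<phi>_def by (rule landau_o.big.mult)
    ultimately show ?thesis
      unfolding R_def
      by (intro norm_sum_bigo) (auto simp: norm_vector_scalar_mult norm_mult intro: landau_o.big_trans)
  qed
  have fp_bigo: "(\<lambda>t. norm (f t - p (log_vec k t))) \<in> O(\<phi> \<nu>)" if "- \<mu> - \<delta>\<^sub>0 \<le> \<nu>" for \<nu>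
    using f_asymp \<phi>_mono[OF that] unfolding \<phi>_def by (rule landau_o.big_trans)
  have "(\<lambda>t. norm (\<Sum>\<alpha>\<in>S. h \<alpha> t *s \<xi> \<alpha>)) \<in> O(\<phi> (- \<mu> + \<eta>))"
    using h_bigo by (intro norm_sum_bigo) (simp add: norm_vector_scalar_mult)
  moreover have "\<forall>\<^sub>F t in at_top. norm (p (log_vec k t)) = norm (\<Sum>\<alpha>\<in>S. h \<alpha> t *s \<xi> \<alpha>)"
    using p_eq by eventually_elim simp
  ultimately have "(\<lambda>t. norm (p (log_vec k t))) \<in> O(\<phi> (- \<mu> + \<eta>))"
    by (simp add: landau_o.big.in_cong)
  with fp_bigo have "(\<lambda>t. norm ((f t - p (log_vec k t)) + p (log_vec k t))) \<in> O(\<phi> (- \<mu> + \<eta>))"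
    using \<eta>(1) delta by (intro norm_add_bigo) auto
  then have f_bigo: "(\<lambda>t. norm (f t)) \<in> O(\<phi> (- \<mu> + \<eta>))"
    by simp
  obtain K where K: "0 < K" "\<forall>\<^sub>F x in nhds 0. norm (F x) \<le> K * norm x powr \<beta>"
    using superlinear_bound_at_0[OF F_cont beta F_bigo] by blast
  then have F_y: "\<forall>\<^sub>F t in at_top. norm (F (y t)) \<le> K * norm (y t) powr \<beta>"
    using eventually_compose_filterlim[OF _ y_lim] by blast
  have y_deriv': "\<forall>\<^sub>F t in at_top. (y has_vector_derivative y' t) (at t)"
    using eventually_gt_at_top[of T\<^sub>0]
  proof eventually_elim
    case (elim t)
    then have "at t within {T\<^sub>0..} = at t"
      by (intro at_within_interior) simp
    with y_deriv[of t] elim show ?case by simp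
  qed
  have y_bigo: "(\<lambda>t. norm (y t)) \<in> O(\<phi> (- \<mu> + \<eta>))"
    unfolding \<phi>_def
  proof (rule linear_decay_iter_log[OF A m y_deriv'])
    fix c :: real assume c: "0 < c"
    obtain C where C: "0 < C" "\<forall>\<^sub>F t in at_top. norm (f t) \<le> C * \<phi> (- \<mu> + \<eta>) t"
      using landau_o.bigE[OF f_bigo] by (auto simp: \<phi>_def)
    \<comment> \<open>As \<open>y\<close> tends to zero, the surplus power
      \<open>\<beta> - 1\<close> turns \<open>F (y t)\<close> into an arbitrarily small multiple of
      \<open>norm (y t)\<close>, which the linear decay absorbs.\<close>
    have "((\<lambda>t. K * norm (y t) powr (\<beta> - 1)) \<longlongrightarrow> K * 0 powr (\<beta> - 1)) at_top"
      using beta y_lim by (intro tendsto_mult tendsto_const tendsto_powr' tendsto_norm_zero) auto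
    then have "\<forall>\<^sub>F t in at_top. K * norm (y t) powr (\<beta> - 1) < c"
      using c by (intro order_tendstoD(2)) auto
    then have "\<forall>\<^sub>F t in at_top.
        norm (y' t + A *v y t) \<le> c * norm (y t) + C * iter_log m t powr (- \<mu> + \<eta>)"
      using C(2) F_y eventually_gt_at_top[of T\<^sub>0]
    proof eventually_elim
      case (elim t)
      have "norm (y t) powr \<beta> = norm (y t) powr (\<beta> - 1) * norm (y t)"
        using powr_add[of "norm (y t)" "\<beta> - 1" 1] by simp
      then have "K * norm (y t) powr \<beta> \<le> c * norm (y t)"
        using elim(1) mult_right_mono[of "K * norm (y t) powr (\<beta> - 1)" c "norm (y t)"] by simp
      with elim ode[of t] norm_triangle_ineq[of "F (y t)" "f t"] show ?case
        by (simp add: \<phi>_def)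
    qed
    with C(1) show "\<exists>C\<ge>0. \<forall>\<^sub>F t in at_top.
        norm (y' t + A *v y t) \<le> c * norm (y t) + C * iter_log m t powr (- \<mu> + \<eta>)"
      by (intro exI[of _ C]) simp
  qed
  have Fy_bigo: "(\<lambda>t. norm (F (y t))) \<in> O(\<phi> (- \<mu> - \<epsilon>))"
  proof -
    have "(\<lambda>t. norm (F (y t))) \<in> O(\<lambda>t. norm (y t) powr \<beta>)"
      using F_y by (intro bigoI[of _ K]) simp
    also have "(\<lambda>t. norm (y t) powr \<beta>) \<in> O(\<lambda>t. \<phi> (- \<mu> + \<eta>) t powr \<beta>)"
      using y_bigo beta by (intro bigo_powr_nonneg) (auto simp: \<phi>_def)
    also have "(\<lambda>t. \<phi> (- \<mu> + \<eta>) t powr \<beta>) = \<phi> ((- \<mu> + \<eta>) * \<beta>)"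
      by (simp add: \<phi>_def powr_powr)
    also have "\<phi> ((- \<mu> + \<eta>) * \<beta>) \<in> O(\<phi> (- \<mu> - \<epsilon>))"
      using \<eta>(3) \<epsilon>(4) by (intro \<phi>_mono) (simp add: field_simps)
    finally show ?thesis .
  qed
  \<comment> \<open>The difference solves the linear equation with forcing
    \<open>F (y t) + (f t - p (log_vec k t)) - R t\<close>, each term of which now has the rate
    \<open>- \<mu> - \<epsilon>\<close>.\<close>
  have "(\<lambda>t. norm (y t - Z t)) \<in> O(\<phi> (- \<mu> - \<epsilon>))"
    unfolding \<phi>_def
  proof (rule linear_decay_iter_log[OF A m])
    show "\<forall>\<^sub>F t in at_top. ((\<lambda>t. y t - Z t) has_vector_derivative (y' t - Z' t)) (at t)"
      using y_deriv' Z_deriv by eventually_elim (rule has_vector_derivative_diff)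
  next
    fix c :: real assume c: "0 < c"
    have "(\<lambda>t. norm (F (y t) + (f t - p (log_vec k t)) + - R t)) \<in> O(\<phi> (- \<mu> - \<epsilon>))"
      using Fy_bigo R_bigo fp_bigo \<epsilon>(2) by (intro norm_add_bigo) auto
    then obtain C where C: "0 < C" "\<forall>\<^sub>F t in at_top.
        norm (F (y t) + (f t - p (log_vec k t)) + - R t) \<le> C * \<phi> (- \<mu> - \<epsilon>) t"
      by (elim landau_o.bigE) (auto simp: \<phi>_def)
    have "\<forall>\<^sub>F t in at_top. norm (y' t - Z' t + A *v (y t - Z t))
        \<le> c * norm (y t - Z t) + C * iter_log m t powr (- \<mu> - \<epsilon>)"
      using C(2) Z_ode eventually_gt_at_top[of T\<^sub>0]
    proof eventually_elim
      case (elim t)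
      have "y' t - Z' t + A *v (y t - Z t) = (y' t + A *v y t) - (Z' t + A *v Z t)"
        by (simp add: vec.diff)
      also have "\<dots> = F (y t) + (f t - p (log_vec k t)) + - R t"
        using elim ode[of t] by simp
      finally have "norm (y' t - Z' t + A *v (y t - Z t)) \<le> C * \<phi> (- \<mu> - \<epsilon>) t"
        using elim(1) by simp
      moreover have "0 \<le> c * norm (y t - Z t)"
        using c by simp
      ultimately show ?case
        by (simp add: \<phi>_def)
    qed
    with C(1) show "\<exists>C\<ge>0. \<forall>\<^sub>F t in at_top. norm (y' t - Z' t + A *v (y t - Z t))
        \<le> c * norm (y t - Z t) + C * iter_log m t powr (- \<mu> - \<epsilon>)"
      by (intro exI[of _ C]) simp
  qed
  with \<epsilon>(1) show ?thesis
    unfolding Z_def \<phi>_def by blast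
qed

end
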